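(* Consider a homogeneous SISO network, that is, a system $x(t+1)=(A+BQC)x(t)+BRu(t)$, $y(t)=SCx(t)$ as described in the context with $m_i=p_i=1$ and $A_i=A_0$, $B_i=B_0$ and $C_i=C_0$ for all $i\in\{1,\dots,N\}$. If the topology of this system is identifiable, then $\operatorname{rank}S=N$ or $\operatorname{rank}R=N$.
   Context: Network model. Let $N\ge 1$. For $i\in\mathcal V:=\{1,2,\dots,N\}$, let $A_i\in\mathbb R^{n_i\times n_i}$, $B_i\in\mathbb R^{n_i\times m_i}$, $C_i\in\mathbb R^{p_i\times n_i}$ define the discrete-time node system $x_i(t+1)=A_ix_i(t)+B_iv_i(t)$, $w_i(t)=C_ix_i(t)$. The nodes are coupled by $v_i(t)=\sum_{j=1}^N Q_{ij}w_j(t)+R_iu(t)$ with external input $u(t)\in\mathbb R^m$, and the external output is $y(t)=\sum_{i=1}^N S_iw_i(t)\in\mathbb R^p$, where $Q_{ij}\in\mathbb R^{m_i\times p_j}$, $R_i\in\mathbb R^{m_i\times m}$, $S_i\in\mathbb R^{p\times p_i}$. Let $A,B,C$ be the block diagonal matrices with diagonal blocks $A_i$, $B_i$, $C_i$ ($i=1,\dots,N$), respectively; let $Q=(Q_{ij})$ be the block matrix with blocks $Q_{ij}$ (the interconnection matrix), let $R$ be the matrix obtained by stacking $R_1,\dots,R_N$ on top of each other, and $S=\begin{pmatrix}S_1&\cdots&S_N\end{pmatrix}$. With $n=\sum_i n_i$ and $x(t)\in\mathbb R^n$ the stacked state, the network is $x(t+1)=(A+BQC)x(t)+BRu(t)$,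 $y(t)=SCx(t)$, $t=0,1,2,\dots$. The matrices $A,B,C,R,S$ are fixed and known. (When $m_i=p_i=1$ for all $i$, one has $Q\in\mathbb R^{N\times N}$, $R\in\mathbb R^{N\times m}$, $S\in\mathbb R^{p\times N}$.) Identifiability. Let $y_{u,x_0,Q}(\cdot)$ denote the output of the network for input $u(\cdot)$, initial condition $x(0)=x_0$ and interconnection matrix $Q$. Two real interconnection matrices $Q,\bar Q$ (of the same size) are indistinguishable if there exist $x_0,\bar x_0\in\mathbb R^n$ such that $y_{u,x_0,Q}(\cdot)=y_{u,\bar x_0,\bar Q}(\cdot)$ for all input functions $u$; otherwise they are distinguishable. The topology of the network with interconnection matrix $Q$ is identifiable if $Q$ and $\bar Q$ are distinguishable for all real $\bar Q\neq Q$. *)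

theory Defs
  imports "Jordan_Normal_Form.DL_Rank"
begin

(* Nodes are numbered 0, ..., N - 1. The blocks may have different, non-square dimensions. *)
definition block_diag :: "nat \<Rightarrow> (nat \<Rightarrow> real mat) \<Rightarrow> real mat" where
  "block_diag N M = diag_block_mat (map M [0..<N])"

fun network_state ::
  "real mat \<Rightarrow> real mat \<Rightarrow> real mat \<Rightarrow> real mat \<Rightarrow> real mat \<Rightarrow> (nat \<Rightarrow> real vec) \<Rightarrow> real vec \<Rightarrow> nat \<Rightarrow> real vec"
where
  "network_state A B C R Q u x0 0 = x0"
| "network_state A B C R Q u x0 (Suc t) =
     (A + B * Q * C) *\<^sub>v network_state A B C R Q u x0 t + (B * R) *\<^sub>v u t"

definition network_output ::
  "real mat \<Rightarrow> real mat \<Rightarrow> real mat \<Rightarrow> real mat \<Rightarrow> real mat \<Rightarrow> real mat \<Rightarrow> (nat \<Rightarrow> real vec) \<Rightarrow> real vec \<Rightarrow> nat \<Rightarrow> real vec"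
where
  "network_output A B C R S Q u x0 t = (S * C) *\<^sub>v network_state A B C R Q u x0 t"

(* The initial states are chosen before, and hence independently of, the input. *)
definition indistinguishable ::
  "real mat \<Rightarrow> real mat \<Rightarrow> real mat \<Rightarrow> real mat \<Rightarrow> real mat \<Rightarrow> real mat \<Rightarrow> real mat \<Rightarrow> bool"
where
  "indistinguishable A B C R S Q Q' \<longleftrightarrow>
     (\<exists>x0 \<in> carrier_vec (dim_row A). \<exists>x0' \<in> carrier_vec (dim_row A).
        \<forall>u. (\<forall>t. u t \<in> carrier_vec (dim_col R)) \<longrightarrow>
          network_output A B C R S Q u x0 = network_output A B C R S Q' u x0')"

(* Q ranges over the matrices for which B * Q * C is defined. *)
definition topology_identifiable ::
  "real mat \<Rightarrow> real mat \<Rightarrow> real mat \<Rightarrow> real mat \<Rightarrow> real mat \<Rightarrow> real mat \<Rightarrow> bool"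
where
  "topology_identifiable A B C R S Q \<longleftrightarrow>
     (\<forall>Q' \<in> carrier_mat (dim_col B) (dim_row C). Q' \<noteq> Q \<longrightarrow> \<not> indistinguishable A B C R S Q Q')"

end

theory Submission
  imports Defs
begin

text \<open>
  The topology is identifiable only if no other interconnection matrix \<open>Q'\<close> reproduces the
  output, so it suffices to construct such a \<open>Q'\<close> when neither \<open>S\<close> nor \<open>R\<close> has rank \<open>N\<close>. In that
  case there are a column \<open>v \<noteq> 0\<close> with \<open>S v = 0\<close> and a row \<open>w \<noteq> 0\<close> with \<open>w R = 0\<close>
  (\<open>column_kernelE\<close>, \<open>row_kernelE\<close>): a direction that the output does not see and a functional that
  the input does not excite.

  Because all nodes are the same, the block diagonal matrices are Kronecker products
  \<open>1 \<otimes> A\<^sub>0\<close>, \<open>1 \<otimes> B\<^sub>0\<close>, \<open>1 \<otimes> C\<^sub>0\<close>, and because the nodes have scalar inputs and outputs, the closed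
  loop is \<open>1 \<otimes> A\<^sub>0 + Q \<otimes> B\<^sub>0 C\<^sub>0\<close>. Hence every linear operation on the nodes, which acts on the
  stacked state as \<open>P \<otimes> 1\<close>, passes through the node dynamics and is felt only by \<open>Q\<close>, \<open>R\<close> and \<open>S\<close>.

  The natural candidate is \<open>Q' = P Q P\<^sup>-\<^sup>1\<close> with \<open>P = 1 + v w\<close>. As \<open>P R = R\<close> and \<open>S P = S\<close>, the
  change of coordinates \<open>P \<otimes> 1\<close> turns every trajectory for \<open>Q\<close> into one for \<open>Q'\<close> with the same
  output (\<open>indistinguishable_if_similar\<close>). This settles the matter unless \<open>Q' = Q\<close>, that is, unless
  \<open>v w\<close> commutes with \<open>Q\<close>. In this exceptional case \<open>w\<close> is a left eigenvector of \<open>Q\<close>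
  (\<open>left_eigenvector_if_commute\<close>), so that \<open>(w \<otimes> 1) x\<close> evolves on its own, unaffected by the input.
  Starting from the zero state it vanishes forever, and \<open>Q' = Q + v w\<close> generates exactly the same
  states as \<open>Q\<close> (\<open>indistinguishable_if_left_eigenvector\<close>).
\<close>

section \<open>Kronecker products\<close>

definition kron :: "'a :: times mat \<Rightarrow> 'a mat \<Rightarrow> 'a mat" where
  "kron M K = mat (dim_row M * dim_row K) (dim_col M * dim_col K)
     (\<lambda>(i, j). M $$ (i div dim_row K, j div dim_col K) * K $$ (i mod dim_row K, j mod dim_col K))"

lemma dim_kron [simp]:
  "dim_row (kron M K) = dim_row M * dim_row K" "dim_col (kron M K) = dim_col M * dim_col K"
  by (simp_all add: kron_def)

lemma kron_carrier:
  "M \<in> carrier_mat a b \<Longrightarrow> K \<in> carrier_mat r c \<Longrightarrow> kron M K \<in> carrier_mat (a * r) (b * c)"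
  by (intro carrier_matI) simp_all

lemma index_kron:
  assumes "M \<in> carrier_mat a b" "K \<in> carrier_mat r c" "i < a * r" "j < b * c"
  shows "kron M K $$ (i, j) = M $$ (i div r, j div c) * K $$ (i mod r, j mod c)"
  using assms by (simp add: kron_def)

lemma div_mod_less:
  fixes i a r :: nat
  assumes "i < a * r"
  shows "i div r < a" "i mod r < r"
proof -
  show "i div r < a" using assms by (simp add: less_mult_imp_div_less)
  have "0 < r" using assms by (cases r) auto
  then show "i mod r < r" by simp
qed

text \<open>The map \<open>k \<mapsto> (k div r, k mod r)\<close> identifies a single index with a pair of indices.\<close>

lemma sum_div_mod:
  fixes f g :: "nat \<Rightarrow> 'a :: comm_semiring_0"
  shows "(\<Sum>k = 0..<n * r. f (k div r) * g (k mod r)) = (\<Sum>i = 0..<n. f i) * (\<Sum>j = 0..<r. g j)"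
proof -
  have "(\<Sum>k = 0..<n * r. f (k div r) * g (k mod r))
      = (\<Sum>i<n. \<Sum>k = i * r..<i * r + r. f (k div r) * g (k mod r))"
    by (simp add: sum.nat_group atLeast0LessThan)
  also have "\<dots> = (\<Sum>i<n. \<Sum>j = 0..<r. f i * g j)"
  proof (rule sum.cong[OF refl])
    fix i
    have "(\<Sum>k = i * r..<i * r + r. f (k div r) * g (k mod r))
        = (\<Sum>j = 0..<r. f ((j + i * r) div r) * g ((j + i * r) mod r))"
      using sum.shift_bounds_nat_ivl[of "\<lambda>k. f (k div r) * g (k mod r)" 0 "i * r" r]
      by (simp add: add.commute)
    also have "\<dots> = (\<Sum>j = 0..<r. f i * g j)"
      by (intro sum.cong) auto
    finally show "(\<Sum>k = i * r..<i * r + r. f (k div r) * g (k mod r)) = (\<Sum>j = 0..<r. f i * g j)" .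
  qed
  finally show ?thesis by (simp add: sum_product atLeast0LessThan)
qed

lemma kron_mult_kron:
  fixes M :: "'a :: comm_semiring_0 mat"
  assumes M: "M \<in> carrier_mat a b" and M': "M' \<in> carrier_mat b c"
    and K: "K \<in> carrier_mat r s" and K': "K' \<in> carrier_mat s t"
  shows "kron M K * kron M' K' = kron (M * M') (K * K')"
proof (rule eq_matI)
  note car = kron_carrier[OF M K] kron_carrier[OF M' K']
  fix i j
  assume "i < dim_row (kron (M * M') (K * K'))" "j < dim_col (kron (M * M') (K * K'))"
  then have i: "i < a * r" and j: "j < c * t" using assms by auto
  have "(kron M K * kron M' K') $$ (i, j)
      = (\<Sum>k = 0..<b * s. kron M K $$ (i, k) * kron M' K' $$ (k, j))"
    using car i j M K M' K' by (simp add: scalar_prod_def)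
  also have "\<dots> = (\<Sum>k = 0..<b * s. (M $$ (i div r, k div s) * M' $$ (k div s, j div t))
                                * (K $$ (i mod r, k mod s) * K' $$ (k mod s, j mod t)))"
    using i j by (intro sum.cong) (auto simp: index_kron[OF M K] index_kron[OF M' K'] ac_simps)
  also have "\<dots> = (\<Sum>k = 0..<b. M $$ (i div r, k) * M' $$ (k, j div t))
                * (\<Sum>k = 0..<s. K $$ (i mod r, k) * K' $$ (k, j mod t))"
    by (rule sum_div_mod)
  also have "\<dots> = (M * M') $$ (i div r, j div t) * (K * K') $$ (i mod r, j mod t)"
    using assms div_mod_less[OF i] div_mod_less[OF j] by (simp add: scalar_prod_def)
  also have "\<dots> = kron (M * M') (K * K') $$ (i, j)"
    using assms i j by (subst index_kron[of _ a c _ r t]) auto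
  finally show "(kron M K * kron M' K') $$ (i, j) = kron (M * M') (K * K') $$ (i, j)" .
qed (use assms in auto)

lemma kron_add_left:
  fixes M :: "'a :: semiring mat"
  assumes "M \<in> carrier_mat a b" "M' \<in> carrier_mat a b" "K \<in> carrier_mat r c"
  shows "kron (M + M') K = kron M K + kron M' K"
  using assms
  by (intro eq_matI) (auto simp: index_kron[where a = a and b = b and r = r and c = c]
      div_mod_less distrib_right)

lemma kron_add_right:
  fixes M :: "'a :: semiring mat"
  assumes "M \<in> carrier_mat a b" "K \<in> carrier_mat r c" "K' \<in> carrier_mat r c"
  shows "kron M (K + K') = kron M K + kron M K'"
  using assms
  by (intro eq_matI) (auto simp: index_kron[where a = a and b = b and r = r and c = c]
      div_mod_less distrib_left)

lemma kron_smult: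
  fixes M :: "'a :: comm_semiring_1 mat"
  shows "kron (l \<cdot>\<^sub>m M) K = kron M (l \<cdot>\<^sub>m K)"
  by (intro eq_matI) (auto simp: kron_def div_mod_less mult.assoc mult.left_commute)

lemma kron_zero_left:
  fixes K :: "'a :: semiring_0 mat"
  assumes "K \<in> carrier_mat r c"
  shows "kron (0\<^sub>m a b) K = 0\<^sub>m (a * r) (b * c)"
  using assms by (intro eq_matI) (auto simp: kron_def div_mod_less)

lemma kron_one_right [simp]:
  fixes M :: "'a :: semiring_1 mat"
  shows "kron M (1\<^sub>m 1) = M"
  by (intro eq_matI) (auto simp: kron_def)

text \<open>
  This is where homogeneity enters: only equal blocks make the block diagonal matrix a Kronecker
  product.
\<close>

lemma block_diag_const:
  assumes K: "K \<in> carrier_mat r c" and M: "\<And>i. i < N \<Longrightarrow> M i = K"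
  shows "block_diag N M = kron (1\<^sub>m N) K"
  using M
proof (induction N)
  case 0
  show ?case by (intro eq_matI) (auto simp: block_diag_def)
next
  case (Suc N)
  let ?D = "kron (1\<^sub>m N) K"
  have IH: "diag_block_mat (map M [0..<N]) = ?D" and [simp]: "M N = K"
    using Suc by (auto simp: block_diag_def)
  have D: "?D \<in> carrier_mat (N * r) (N * c)" by (rule kron_carrier[OF one_carrier_mat K])
  have last_block: "x div y = N" "x mod y = x - N * y" if "\<not> x < N * y" "x < N * y + y" for x y :: nat
  proof -
    show "x div y = N" using that by (intro div_nat_eqI) (auto simp: algebra_simps)
    then show "x mod y = x - N * y" by (simp add: modulo_nat_def mult.commute)
  qed
  have "block_diag (Suc N) M = four_block_mat ?D (0\<^sub>m (N * r) c) (0\<^sub>m r (N * c)) K"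
    using K D by (simp add: block_diag_def diag_block_mat_last IH Let_def)
  also have "\<dots> = kron (1\<^sub>m (Suc N)) K"
  proof (rule eq_matI)
    fix i j
    assume "i < dim_row (kron (1\<^sub>m (Suc N)) K)" "j < dim_col (kron (1\<^sub>m (Suc N)) K)"
    then have i: "i < N * r + r" and j: "j < N * c + c" using K by (auto simp: algebra_simps)
    show "four_block_mat ?D (0\<^sub>m (N * r) c) (0\<^sub>m r (N * c)) K $$ (i, j) = kron (1\<^sub>m (Suc N)) K $$ (i, j)"
      using i j K D last_block[of i r] last_block[of j c] div_mod_less[of i N r] div_mod_less[of j N c]
      by (auto simp: index_kron[OF one_carrier_mat K] add.commute)
  qed (use K in auto)
  finally show ?case .
qed


section \<open>Kernels of matrices of deficient rank\<close>

lemma rank_less_ncE: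
  fixes S :: "'a :: field mat"
  assumes S: "S \<in> carrier_mat p N" and rank: "vec_space.rank p S \<noteq> N"
  obtains v where "v \<in> carrier_vec N" "v \<noteq> 0\<^sub>v N" "S *\<^sub>v v = 0\<^sub>v p"
proof -
  interpret vec_space "TYPE('a)" p .
  show ?thesis
  proof (cases "distinct (cols S)")
    case True
    then have "lin_dep (set (cols S))"
      using lin_indpt_full_rank[OF S] rank by blast
    then show ?thesis using lin_depE[OF S _ True] that by blast
  next
    case False
    then obtain i j where ij: "i < N" "j < N" "i \<noteq> j" "col S i = col S j"
      using S by (auto simp: distinct_conv_nth)
    (* Repeated columns collapse in the set of columns, but they give a kernel vector directly. *)
    let ?v = "unit_vec N i - unit_vec N j :: 'a vec"
    show ?thesis
    proof (rule that[of ?v])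
      have "?v $ i \<noteq> 0\<^sub>v N $ i" using ij by simp
      then show "?v \<noteq> 0\<^sub>v N" by metis
      have "S *\<^sub>v ?v = S *\<^sub>v unit_vec N i - S *\<^sub>v unit_vec N j"
        using S by (intro mult_minus_distrib_mat_vec) auto
      also have "\<dots> = col S i - col S j"
        using S ij(1,2) by (intro arg_cong2[where f = "(-)"] eq_vecI) auto
      finally show "S *\<^sub>v ?v = 0\<^sub>v p" using S ij by auto
    qed auto
  qed
qed

text \<open>
  The square matrix \<open>R R\<^sup>T\<close> lets determinants decide: if it is invertible, then \<open>R\<close> is onto and has
  rank \<open>N\<close>; otherwise it kills some \<open>w \<noteq> 0\<close>, and \<open>\<parallel>R\<^sup>T w\<parallel>\<^sup>2 = w \<bullet> R R\<^sup>T w = 0\<close>. The last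
  step is where the scalars have to be real.
\<close>

lemma rank_less_nrE:
  fixes R :: "real mat"
  assumes R: "R \<in> carrier_mat N m" and rank: "vec_space.rank N R \<noteq> N"
  obtains w where "w \<in> carrier_vec N" "w \<noteq> 0\<^sub>v N" "R\<^sup>T *\<^sub>v w = 0\<^sub>v m"
proof -
  interpret vec_space "TYPE(real)" N .
  have G: "R * R\<^sup>T \<in> carrier_mat N N" using R by simp
  have "det (R * R\<^sup>T) = 0"
  proof (rule ccontr)
    assume "det (R * R\<^sup>T) \<noteq> 0"
    from det_non_zero_imp_unit[OF G this, of "()"]
    obtain H where H: "H \<in> carrier_mat N N" "R * R\<^sup>T * H = 1\<^sub>m N"
      unfolding Units_def ring_mat_def by auto
    have "y \<in> col_space R" if y: "y \<in> carrier_vec N" for y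
    proof -
      have "R *\<^sub>v (R\<^sup>T * H *\<^sub>v y) = R * (R\<^sup>T * H) *\<^sub>v y"
        using R H(1) y by (intro assoc_mult_mat_vec[symmetric]) auto
      also have "R * (R\<^sup>T * H) = R * R\<^sup>T * H"
        using R H(1) by (intro assoc_mult_mat[symmetric]) auto
      finally have "R *\<^sub>v (R\<^sup>T * H *\<^sub>v y) = y" using y by (simp only: H(2) one_mult_mat_vec)
      moreover have "R\<^sup>T * H *\<^sub>v y \<in> carrier_vec m" using R H y by auto
      ultimately show ?thesis using R y by (auto simp: col_space_eq[OF R])
    qed
    moreover have "col_space R \<subseteq> carrier_vec N" using R by (auto simp: col_space_eq[OF R])
    ultimately have "span (set (cols R)) = carrier_vec N" by (auto simp: col_space_def)
    then have "rank R = dim" by (simp add: rank_def module_vec_def)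
    then show False using rank dim_is_n by simp
  qed
  then obtain w where w: "w \<in> carrier_vec N" "w \<noteq> 0\<^sub>v N" "R * R\<^sup>T *\<^sub>v w = 0\<^sub>v N"
    using det_0_iff_vec_prod_zero_field[OF G] by blast
  have Rw: "R\<^sup>T *\<^sub>v w \<in> carrier_vec m" using R w by auto
  have "(R\<^sup>T *\<^sub>v w) \<bullet> (R\<^sup>T *\<^sub>v w) = w \<bullet> (R *\<^sub>v (R\<^sup>T *\<^sub>v w))"
    using transpose_vec_mult_scalar[OF R Rw w(1)] R w Rw
    by (simp add: comm_scalar_prod[of _ m])
  also have "R *\<^sub>v (R\<^sup>T *\<^sub>v w) = 0\<^sub>v N"
    using assoc_mult_mat_vec[OF R _ w(1), of "R\<^sup>T"] R w(3) by simp
  also have "w \<bullet> 0\<^sub>v N = 0" using w(1) by simp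
  finally have "R\<^sup>T *\<^sub>v w = 0\<^sub>v m"
    using conjugate_square_eq_0_vec[OF Rw] by simp
  then show ?thesis using that w by blast
qed


lemma column_kernelE:
  fixes S :: "'a :: field mat"
  assumes S: "S \<in> carrier_mat p N" and "vec_space.rank p S \<noteq> N"
  obtains v where "v \<in> carrier_mat N 1" "v \<noteq> 0\<^sub>m N 1" "S * v = 0\<^sub>m p 1"
proof -
  obtain x where x: "x \<in> carrier_vec N" "x \<noteq> 0\<^sub>v N" "S *\<^sub>v x = 0\<^sub>v p"
    using rank_less_ncE[OF assms] by blast
  let ?v = "mat_of_cols N [x]"
  have col: "col ?v 0 = x" using x by simp
  show ?thesis
  proof (rule that)
    show "?v \<in> carrier_mat N 1" by (rule carrier_matI) simp_all
    show "?v \<noteq> 0\<^sub>m N 1" using col x(2) by (metis col_zero less_one)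
    show "S * ?v = 0\<^sub>m p 1"
    proof (rule eq_matI)
      fix i j assume "i < dim_row (0\<^sub>m p 1 :: 'a mat)" "j < dim_col (0\<^sub>m p 1 :: 'a mat)"
      then have "i < p" "j = 0" by auto
      then show "(S * ?v) $$ (i, j) = 0\<^sub>m p 1 $$ (i, j)"
        using S col arg_cong[OF x(3), of "\<lambda>y. y $ i"] by simp
    qed (use S in auto)
  qed
qed

lemma row_kernelE:
  fixes R :: "real mat"
  assumes R: "R \<in> carrier_mat N m" and "vec_space.rank N R \<noteq> N"
  obtains w where "w \<in> carrier_mat 1 N" "w \<noteq> 0\<^sub>m 1 N" "w * R = 0\<^sub>m 1 m"
proof -
  obtain x where x: "x \<in> carrier_vec N" "x \<noteq> 0\<^sub>v N" "R\<^sup>T *\<^sub>v x = 0\<^sub>v m"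
    using rank_less_nrE[OF assms] by blast
  let ?w = "mat_of_rows N [x]"
  have row: "row ?w 0 = x" using x by simp
  show ?thesis
  proof (rule that)
    show "?w \<in> carrier_mat 1 N" by (rule carrier_matI) simp_all
    show "?w \<noteq> 0\<^sub>m 1 N" using row x(2) by (metis row_zero less_one)
    show "?w * R = 0\<^sub>m 1 m"
    proof (rule eq_matI)
      fix i j assume "i < dim_row (0\<^sub>m 1 m :: real mat)" "j < dim_col (0\<^sub>m 1 m :: real mat)"
      then have ij: "i = 0" "j < m" by auto
      have "x \<bullet> col R j = col R j \<bullet> x"
        using x(1) R by (intro comm_scalar_prod) auto
      then show "(?w * R) $$ (i, j) = 0\<^sub>m 1 m $$ (i, j)"
        using R row ij arg_cong[OF x(3), of "\<lambda>y. y $ j"] by simp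
    qed (use R in auto)
  qed
qed

section \<open>Rank-one matrices\<close>

text \<open>The Sherman--Morrison formula; it rests on \<open>(v w)(v w) = (w v)(v w)\<close>, where \<open>w v\<close> is a scalar.\<close>

lemma rank_one_update_left_inverse:
  fixes v w :: "'a :: field mat"
  assumes v: "v \<in> carrier_mat N 1" and w: "w \<in> carrier_mat 1 N"
    and s: "(w * v) $$ (0, 0) = s" "s \<noteq> - 1"
  defines "P' \<equiv> 1\<^sub>m N - (1 / (1 + s)) \<cdot>\<^sub>m (v * w)"
  shows "P' * (1\<^sub>m N + v * w) = 1\<^sub>m N"
proof -
  let ?E = "v * w"
  have E: "?E \<in> carrier_mat N N" using v w by simp
  have P': "P' \<in> carrier_mat N N" unfolding P'_def by (intro minus_carrier_mat smult_carrier_mat E)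
  have "w * v = s \<cdot>\<^sub>m 1\<^sub>m 1" using v w s(1) by (intro eq_matI) auto
  then have "?E * ?E = v * (s \<cdot>\<^sub>m 1\<^sub>m 1 * w)"
    using assoc_mult_mat[OF v w E] assoc_mult_mat[OF w v w] by simp
  also have "s \<cdot>\<^sub>m 1\<^sub>m 1 * w = s \<cdot>\<^sub>m w"
    unfolding mult_smult_assoc_mat[OF one_carrier_mat w] left_mult_one_mat[OF w] ..
  also have "v * (s \<cdot>\<^sub>m w) = s \<cdot>\<^sub>m ?E" by (rule mult_smult_distrib[OF v w])
  finally have EE: "?E * ?E = s \<cdot>\<^sub>m ?E" .
  have "P' * (1\<^sub>m N + ?E) = P' + P' * ?E"
    unfolding mult_add_distrib_mat[OF P' one_carrier_mat E] right_mult_one_mat[OF P'] ..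
  also have "P' * ?E = ?E - (1 / (1 + s)) \<cdot>\<^sub>m (s \<cdot>\<^sub>m ?E)"
    unfolding P'_def minus_mult_distrib_mat[OF one_carrier_mat smult_carrier_mat[OF E] E]
      mult_smult_assoc_mat[OF E E] EE left_mult_one_mat[OF E] ..
  also have "P' + \<dots> = 1\<^sub>m N"
  proof (rule eq_matI)
    have "1 + s \<noteq> 0" using s(2) by (metis add.commute add_eq_0_iff)
    then have c: "1 / (1 + s) * (1 + s) = 1" by simp
    have "x - 1 / (1 + s) * e + (e - 1 / (1 + s) * (s * e)) = x" for x e :: 'a
    proof -
      have "x - d * e + (e - d * (s * e)) = x + (1 - d * (1 + s)) * e" for d
        by (simp add: algebra_simps)
      then show ?thesis by (simp only: c diff_self mult_zero_left add_0_right)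
    qed
    then show "i < dim_row (1\<^sub>m N) \<Longrightarrow> j < dim_col (1\<^sub>m N) \<Longrightarrow>
        (P' + (?E - (1 / (1 + s)) \<cdot>\<^sub>m (s \<cdot>\<^sub>m ?E))) $$ (i, j) = 1\<^sub>m N $$ (i, j)" for i j
      unfolding P'_def using E by (simp del: index_mult_mat add: carrier_matD[OF E])
  qed (use E P' in auto)
  finally show ?thesis .
qed

text \<open>
  The two sides \<open>v (w Q)\<close> and \<open>(Q v) w\<close> are outer products. Comparing them in a row where \<open>v\<close> does
  not vanish shows that \<open>w Q\<close> is a multiple of \<open>w\<close>.
\<close>

lemma left_eigenvector_if_commute:
  fixes v w Q :: "'a :: field mat"
  assumes v: "v \<in> carrier_mat N 1" "v \<noteq> 0\<^sub>m N 1" and w: "w \<in> carrier_mat 1 N"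
    and Q: "Q \<in> carrier_mat N N" and comm: "v * w * Q = Q * (v * w)"
  obtains l where "w * Q = l \<cdot>\<^sub>m w"
proof -
  obtain i where i: "i < N" "v $$ (i, 0) \<noteq> 0"
    using v by (metis One_nat_def carrier_matD eq_matI index_zero_mat less_one)
  have "w * Q = ((Q * v) $$ (i, 0) / v $$ (i, 0)) \<cdot>\<^sub>m w"
  proof (rule eq_matI)
    fix a j
    assume "a < dim_row (((Q * v) $$ (i, 0) / v $$ (i, 0)) \<cdot>\<^sub>m w)"
      "j < dim_col (((Q * v) $$ (i, 0) / v $$ (i, 0)) \<cdot>\<^sub>m w)"
    then have a: "a = 0" and j: "j < N" using w by auto
    have outer: "(x * y) $$ (i, j) = x $$ (i, 0) * y $$ (0, j)"
      if "x \<in> carrier_mat N 1" "y \<in> carrier_mat 1 N" for x y :: "'a mat"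
      using that i(1) j by (auto simp: scalar_prod_def)
    have "v * (w * Q) = Q * v * w"
      using comm assoc_mult_mat[OF v(1) w Q] assoc_mult_mat[OF Q v(1) w] by simp
    then have "v $$ (i, 0) * (w * Q) $$ (0, j) = (Q * v) $$ (i, 0) * w $$ (0, j)"
      using outer[OF v(1) mult_carrier_mat[OF w Q]] outer[OF mult_carrier_mat[OF Q v(1)] w] by simp
    then show "(w * Q) $$ (a, j) = (((Q * v) $$ (i, 0) / v $$ (i, 0)) \<cdot>\<^sub>m w) $$ (a, j)"
      using i(2) j w a by (simp del: index_mult_mat add: field_simps)
  qed (use w Q in auto)
  then show ?thesis using that by blast
qed

section \<open>Trajectories of networks related by a linear map\<close>

lemma network_state_carrier:
  assumes "A + B * Q * C \<in> carrier_mat n n" "B * R \<in> carrier_mat n m"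
    and "x0 \<in> carrier_vec n" "\<And>t. u t \<in> carrier_vec m"
  shows "network_state A B C R Q u x0 t \<in> carrier_vec n"
proof (induction t)
  case (Suc t)
  show ?case
    using mult_mat_vec_carrier[OF assms(1) Suc.IH] mult_mat_vec_carrier[OF assms(2,4), of t] by simp
qed (simp add: assms)

lemma network_state_intertwine:
  assumes F: "A + B * Q * C \<in> carrier_mat n n" and F': "A + B * Q' * C \<in> carrier_mat n n"
    and G: "B * R \<in> carrier_mat n m" and P: "P \<in> carrier_mat n n"
    and PF: "P * (A + B * Q * C) = (A + B * Q' * C) * P" and PG: "P * (B * R) = B * R"
    and x0: "x0 \<in> carrier_vec n" and u: "\<And>t. u t \<in> carrier_vec m"
  shows "network_state A B C R Q' u (P *\<^sub>v x0) t = P *\<^sub>v network_state A B C R Q u x0 t"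
proof (induction t)
  case (Suc t)
  let ?F = "A + B * Q * C" and ?F' = "A + B * Q' * C" and ?G = "B * R"
  let ?x = "network_state A B C R Q u x0 t"
  have x: "?x \<in> carrier_vec n" by (rule network_state_carrier[OF F G x0 u])
  have "P *\<^sub>v (?F *\<^sub>v ?x + ?G *\<^sub>v u t) = P *\<^sub>v (?F *\<^sub>v ?x) + P *\<^sub>v (?G *\<^sub>v u t)"
    by (rule mult_add_distrib_mat_vec[OF P mult_mat_vec_carrier[OF F x] mult_mat_vec_carrier[OF G u]])
  also have "\<dots> = (P * ?F) *\<^sub>v ?x + (P * ?G) *\<^sub>v u t"
    using assoc_mult_mat_vec[OF P F x] assoc_mult_mat_vec[OF P G u[of t]] by simp
  also have "\<dots> = ?F' *\<^sub>v (P *\<^sub>v ?x) + ?G *\<^sub>v u t"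
    unfolding PF PG using assoc_mult_mat_vec[OF F' P x] by simp
  finally show ?case using Suc.IH by simp
qed simp

text \<open>
  \<open>P\<close> carries trajectories of the first network to trajectories of the second one, and the output
  map does not notice it.
\<close>

lemma indistinguishable_if_intertwined:
  assumes A: "A \<in> carrier_mat n n"
    and F: "A + B * Q * C \<in> carrier_mat n n" and F': "A + B * Q' * C \<in> carrier_mat n n"
    and G: "B * R \<in> carrier_mat n (dim_col R)" and H: "S * C \<in> carrier_mat p n"
    and P: "P \<in> carrier_mat n n" and PF: "P * (A + B * Q * C) = (A + B * Q' * C) * P"
    and PG: "P * (B * R) = B * R" and HP: "S * C * P = S * C"
  shows "indistinguishable A B C R S Q Q'"
  unfolding indistinguishable_def
proof (intro bexI allI impI ext)
  fix u :: "nat \<Rightarrow> real vec" and t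
  assume u: "\<forall>t. u t \<in> carrier_vec (dim_col R)"
  let ?x = "network_state A B C R Q u (0\<^sub>v n) t"
  have x: "?x \<in> carrier_vec n"
    using u by (intro network_state_carrier[OF F G]) auto
  have "network_state A B C R Q' u (P *\<^sub>v 0\<^sub>v n) t = P *\<^sub>v ?x"
    using u by (intro network_state_intertwine[OF F F' G P PF PG]) auto
  moreover have "(S * C) *\<^sub>v (P *\<^sub>v ?x) = (S * C) *\<^sub>v ?x"
    using assoc_mult_mat_vec[OF H P x] HP by simp
  ultimately show "network_output A B C R S Q u (0\<^sub>v n) t
      = network_output A B C R S Q' u (P *\<^sub>v 0\<^sub>v n) t"
    by (simp add: network_output_def)
qed (use A P in auto)

text \<open>
  The quantity \<open>W x\<close> obeys the autonomous recursion \<open>z(t+1) = L z(t)\<close>, so the input cannot move it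
  away from zero.
\<close>

lemma network_state_annihilated:
  assumes F: "A + B * Q * C \<in> carrier_mat n n" and G: "B * R \<in> carrier_mat n m"
    and W: "W \<in> carrier_mat r n" and L: "L \<in> carrier_mat r r"
    and WF: "W * (A + B * Q * C) = L * W" and WG: "W * (B * R) = 0\<^sub>m r m"
    and u: "\<And>t. u t \<in> carrier_vec m"
  shows "W *\<^sub>v network_state A B C R Q u (0\<^sub>v n) t = 0\<^sub>v r"
proof (induction t)
  case 0
  show ?case using W by auto
next
  case (Suc t)
  let ?F = "A + B * Q * C" and ?G = "B * R"
  let ?x = "network_state A B C R Q u (0\<^sub>v n) t"
  have x: "?x \<in> carrier_vec n" by (rule network_state_carrier[OF F G zero_carrier_vec u])
  have "W *\<^sub>v (?F *\<^sub>v ?x + ?G *\<^sub>v u t) = W *\<^sub>v (?F *\<^sub>v ?x) + W *\<^sub>v (?G *\<^sub>v u t)"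
    by (rule mult_add_distrib_mat_vec[OF W mult_mat_vec_carrier[OF F x] mult_mat_vec_carrier[OF G u]])
  also have "\<dots> = (W * ?F) *\<^sub>v ?x + (W * ?G) *\<^sub>v u t"
    using assoc_mult_mat_vec[OF W F x] assoc_mult_mat_vec[OF W G u[of t]] by simp
  also have "\<dots> = L *\<^sub>v (W *\<^sub>v ?x) + 0\<^sub>m r m *\<^sub>v u t"
    unfolding WF WG using assoc_mult_mat_vec[OF L W x] by simp
  also have "\<dots> = 0\<^sub>v r" using Suc.IH L u[of t] by auto
  finally show ?case by simp
qed

text \<open>
  The closed loops differ only by a term \<open>D W\<close>, which acts on states that are never reached from
  the origin.
\<close>

lemma indistinguishable_if_unreachable:
  assumes A: "A \<in> carrier_mat n n" and F: "A + B * Q * C \<in> carrier_mat n n"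
    and G: "B * R \<in> carrier_mat n (dim_col R)"
    and W: "W \<in> carrier_mat r n" and L: "L \<in> carrier_mat r r" and D: "D \<in> carrier_mat n r"
    and WF: "W * (A + B * Q * C) = L * W" and WG: "W * (B * R) = 0\<^sub>m r (dim_col R)"
    and F'_eq: "A + B * Q' * C = (A + B * Q * C) + D * W"
  shows "indistinguishable A B C R S Q Q'"
  unfolding indistinguishable_def
proof (intro bexI allI impI ext)
  fix u :: "nat \<Rightarrow> real vec" and t
  assume "\<forall>t. u t \<in> carrier_vec (dim_col R)"
  then have u: "u t \<in> carrier_vec (dim_col R)" for t by blast
  have "network_state A B C R Q' u (0\<^sub>v n) t = network_state A B C R Q u (0\<^sub>v n) t"
  proof (induction t)
    case (Suc t)
    let ?F = "A + B * Q * C" and ?x = "network_state A B C R Q u (0\<^sub>v n) t"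
    have x: "?x \<in> carrier_vec n" by (rule network_state_carrier[OF F G zero_carrier_vec u])
    have "(?F + D * W) *\<^sub>v ?x = ?F *\<^sub>v ?x + D *\<^sub>v (W *\<^sub>v ?x)"
      using add_mult_distrib_mat_vec[OF F mult_carrier_mat[OF D W] x] assoc_mult_mat_vec[OF D W x]
      by simp
    also have "W *\<^sub>v ?x = 0\<^sub>v r"
      by (rule network_state_annihilated[OF F G W L WF WG u])
    also have "D *\<^sub>v 0\<^sub>v r = 0\<^sub>v n" using D by auto
    also have "?F *\<^sub>v ?x + 0\<^sub>v n = ?F *\<^sub>v ?x"
      by (rule right_zero_vec[OF mult_mat_vec_carrier[OF F x]])
    finally show ?case using Suc.IH by (simp add: F'_eq)
  qed simp
  then show "network_output A B C R S Q u (0\<^sub>v n) t = network_output A B C R S Q' u (0\<^sub>v n) t"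
    by (simp add: network_output_def)
qed (use A in auto)

section \<open>Homogeneous networks with scalar node inputs and outputs\<close>

locale homogeneous_network =
  fixes N n m p :: nat and A\<^sub>0 B\<^sub>0 C\<^sub>0 Q R S :: "real mat"
  assumes A\<^sub>0: "A\<^sub>0 \<in> carrier_mat n n" and B\<^sub>0: "B\<^sub>0 \<in> carrier_mat n 1" and C\<^sub>0: "C\<^sub>0 \<in> carrier_mat 1 n"
    and Q: "Q \<in> carrier_mat N N" and R: "R \<in> carrier_mat N m" and S: "S \<in> carrier_mat p N"
begin

abbreviation "A \<equiv> kron (1\<^sub>m N) A\<^sub>0"
abbreviation "B \<equiv> kron (1\<^sub>m N) B\<^sub>0"
abbreviation "C \<equiv> kron (1\<^sub>m N) C\<^sub>0"

text \<open>
  With scalar node inputs a matrix \<open>M\<close> acting on the node inputs is \<open>M \<otimes> 1\<close>, so the mixed product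
  rule applies; likewise for the node outputs.
\<close>

lemma input_matrix:
  assumes M: "M \<in> carrier_mat N k"
  shows "B * M = kron M B\<^sub>0"
proof -
  have "B * kron M (1\<^sub>m 1) = kron M B\<^sub>0"
    unfolding kron_mult_kron[OF one_carrier_mat M B\<^sub>0 one_carrier_mat]
      left_mult_one_mat[OF M] right_mult_one_mat[OF B\<^sub>0] ..
  then show ?thesis unfolding kron_one_right .
qed

lemma output_matrix:
  assumes M: "M \<in> carrier_mat k N"
  shows "M * C = kron M C\<^sub>0"
proof -
  have "kron M (1\<^sub>m 1) * C = kron M C\<^sub>0"
    unfolding kron_mult_kron[OF M one_carrier_mat one_carrier_mat C\<^sub>0]
      right_mult_one_mat[OF M] left_mult_one_mat[OF C\<^sub>0] ..
  then show ?thesis unfolding kron_one_right .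
qed

lemma closed_loop:
  assumes Q': "Q' \<in> carrier_mat N N"
  shows "A + B * Q' * C = A + kron Q' (B\<^sub>0 * C\<^sub>0)"
  unfolding input_matrix[OF Q'] kron_mult_kron[OF Q' one_carrier_mat B\<^sub>0 C\<^sub>0]
    right_mult_one_mat[OF Q'] ..

lemma BC: "B\<^sub>0 * C\<^sub>0 \<in> carrier_mat n n"
  by (rule mult_carrier_mat[OF B\<^sub>0 C\<^sub>0])

lemma A_carrier: "A \<in> carrier_mat (N * n) (N * n)"
  by (rule kron_carrier[OF one_carrier_mat A\<^sub>0])

lemma closed_loop_carrier:
  assumes "Q' \<in> carrier_mat N N"
  shows "A + B * Q' * C \<in> carrier_mat (N * n) (N * n)"
  unfolding closed_loop[OF assms] by (intro add_carrier_mat kron_carrier[OF assms BC])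

lemma input_carrier: "B * R \<in> carrier_mat (N * n) (dim_col R)"
  unfolding input_matrix[OF R] using kron_carrier[OF R B\<^sub>0] R by simp

lemma output_carrier: "S * C \<in> carrier_mat p (N * n)"
  unfolding output_matrix[OF S] using kron_carrier[OF S C\<^sub>0] by simp

text \<open>
  Coordinate changes \<open>P \<otimes> 1\<close> commute with the node dynamics \<open>1 \<otimes> A\<^sub>0\<close> and intertwine
  \<open>Q \<otimes> B\<^sub>0 C\<^sub>0\<close> with \<open>Q' \<otimes> B\<^sub>0 C\<^sub>0\<close>.
\<close>

lemma indistinguishable_if_similar:
  assumes P: "P \<in> carrier_mat N N" and Q': "Q' \<in> carrier_mat N N"
    and PQ: "P * Q = Q' * P" and PR: "P * R = R" and SP: "S * P = S"
  shows "indistinguishable A B C R S Q Q'"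
proof (rule indistinguishable_if_intertwined[OF A_carrier closed_loop_carrier[OF Q]
      closed_loop_carrier[OF Q'] input_carrier output_carrier])
  note I = one_carrier_mat[of N] one_carrier_mat[of n]
  let ?P = "kron P (1\<^sub>m n)"
  show K: "?P \<in> carrier_mat (N * n) (N * n)" by (rule kron_carrier[OF P I(2)])
  have "?P * A = A * ?P"
    unfolding kron_mult_kron[OF P I(1) I(2) A\<^sub>0] kron_mult_kron[OF I(1) P A\<^sub>0 I(2)]
    using P A\<^sub>0 by simp
  moreover have "?P * kron Q (B\<^sub>0 * C\<^sub>0) = kron Q' (B\<^sub>0 * C\<^sub>0) * ?P"
    unfolding kron_mult_kron[OF P Q I(2) BC] kron_mult_kron[OF Q' P BC I(2)]
    unfolding left_mult_one_mat[OF BC] right_mult_one_mat[OF BC] PQ ..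
  ultimately show "?P * (A + B * Q * C) = (A + B * Q' * C) * ?P"
    unfolding closed_loop[OF Q] closed_loop[OF Q']
    using mult_add_distrib_mat[OF K A_carrier kron_carrier[OF Q BC]]
      add_mult_distrib_mat[OF A_carrier kron_carrier[OF Q' BC] K] by simp
  show "?P * (B * R) = B * R"
    unfolding input_matrix[OF R] kron_mult_kron[OF P R I(2) B\<^sub>0] PR left_mult_one_mat[OF B\<^sub>0] ..
  show "S * C * ?P = S * C"
    unfolding output_matrix[OF S] kron_mult_kron[OF S P C\<^sub>0 I(2)] SP right_mult_one_mat[OF C\<^sub>0] ..
qed

text \<open>
  Applying \<open>w \<otimes> 1\<close> to the state yields a single node with output feedback of gain \<open>l\<close> and without
  input; its dynamics \<open>A\<^sub>0 + l B\<^sub>0 C\<^sub>0\<close> form the autonomous recursion. Since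
  \<open>v w \<otimes> B\<^sub>0 C\<^sub>0 = (v \<otimes> B\<^sub>0 C\<^sub>0)(w \<otimes> 1)\<close>, the perturbation only sees this projection.
\<close>

lemma indistinguishable_if_left_eigenvector:
  assumes v: "v \<in> carrier_mat N 1" and w: "w \<in> carrier_mat 1 N"
    and wQ: "w * Q = l \<cdot>\<^sub>m w" and wR: "w * R = 0\<^sub>m 1 m"
  shows "indistinguishable A B C R S Q (Q + v * w)"
proof (rule indistinguishable_if_unreachable[OF A_carrier closed_loop_carrier[OF Q] input_carrier])
  note I = one_carrier_mat[of N] one_carrier_mat[of n] one_carrier_mat[of 1]
  let ?W = "kron w (1\<^sub>m n)" and ?L = "kron (1\<^sub>m 1) (A\<^sub>0 + l \<cdot>\<^sub>m (B\<^sub>0 * C\<^sub>0))"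
    and ?D = "kron v (B\<^sub>0 * C\<^sub>0)"
  have lBC: "l \<cdot>\<^sub>m (B\<^sub>0 * C\<^sub>0) \<in> carrier_mat n n" using BC by simp
  have vw: "v * w \<in> carrier_mat N N" using v w by simp
  show W: "?W \<in> carrier_mat (1 * n) (N * n)" by (rule kron_carrier[OF w I(2)])
  show "?L \<in> carrier_mat (1 * n) (1 * n)" by (rule kron_carrier[OF I(3) add_carrier_mat[OF lBC]])
  show "?D \<in> carrier_mat (N * n) (1 * n)" by (rule kron_carrier[OF v BC])
  have "?W * (A + B * Q * C) = ?W * A + ?W * kron Q (B\<^sub>0 * C\<^sub>0)"
    unfolding closed_loop[OF Q] by (rule mult_add_distrib_mat[OF W A_carrier kron_carrier[OF Q BC]])
  also have "\<dots> = kron w A\<^sub>0 + kron w (l \<cdot>\<^sub>m (B\<^sub>0 * C\<^sub>0))"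
    unfolding kron_mult_kron[OF w I(1) I(2) A\<^sub>0] kron_mult_kron[OF w Q I(2) BC]
      left_mult_one_mat[OF A\<^sub>0] left_mult_one_mat[OF BC] right_mult_one_mat[OF w] wQ kron_smult ..
  also have "\<dots> = kron w (A\<^sub>0 + l \<cdot>\<^sub>m (B\<^sub>0 * C\<^sub>0))" by (rule kron_add_right[OF w A\<^sub>0 lBC, symmetric])
  also have "\<dots> = ?L * ?W"
    unfolding kron_mult_kron[OF I(3) w add_carrier_mat[OF lBC] I(2)]
      left_mult_one_mat[OF w] right_mult_one_mat[OF add_carrier_mat[OF lBC]] ..
  finally show "?W * (A + B * Q * C) = ?L * ?W" .
  show "?W * (B * R) = 0\<^sub>m (1 * n) (dim_col R)"
    unfolding input_matrix[OF R] kron_mult_kron[OF w R I(2) B\<^sub>0] left_mult_one_mat[OF B\<^sub>0] wR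
      kron_zero_left[OF B\<^sub>0] using R by simp
  have "A + B * (Q + v * w) * C = A + (kron Q (B\<^sub>0 * C\<^sub>0) + kron (v * w) (B\<^sub>0 * C\<^sub>0))"
    unfolding closed_loop[OF add_carrier_mat[OF vw]] kron_add_left[OF Q vw BC] ..
  also have "kron (v * w) (B\<^sub>0 * C\<^sub>0) = ?D * ?W"
    unfolding kron_mult_kron[OF v w BC I(2)] right_mult_one_mat[OF BC] ..
  also have "A + (kron Q (B\<^sub>0 * C\<^sub>0) + ?D * ?W) = A + B * Q * C + ?D * ?W"
    unfolding closed_loop[OF Q]
    by (rule assoc_add_mat[OF A_carrier kron_carrier[OF Q BC]
          mult_carrier_mat[OF kron_carrier[OF v BC] W], symmetric])
  finally show "A + B * (Q + v * w) * C = A + B * Q * C + ?D * ?W" .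
qed

end


section \<open>Rank deficiency on both sides destroys identifiability\<close>

lemma (in homogeneous_network) exists_indistinguishable:
  assumes rankS: "vec_space.rank p S \<noteq> N" and rankR: "vec_space.rank N R \<noteq> N"
  obtains Q' where "Q' \<in> carrier_mat N N" "Q' \<noteq> Q" "indistinguishable A B C R S Q Q'"
proof -
  obtain v where v: "v \<in> carrier_mat N 1" "v \<noteq> 0\<^sub>m N 1" and Sv: "S * v = 0\<^sub>m p 1"
    using column_kernelE[OF S rankS] .
  (* Only the scalar w v = -1 makes 1 + v w singular; changing the sign of w avoids it. *)
  obtain w where w: "w \<in> carrier_mat 1 N" "w \<noteq> 0\<^sub>m 1 N" and wR: "w * R = 0\<^sub>m 1 m"
    and s: "(w * v) $$ (0, 0) \<noteq> - 1"
  proof -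
    obtain x where x: "x \<in> carrier_mat 1 N" "x \<noteq> 0\<^sub>m 1 N" "x * R = 0\<^sub>m 1 m"
      using row_kernelE[OF R rankR] .
    show thesis
    proof (cases "(x * v) $$ (0, 0) = - 1")
      case False
      then show thesis using that x by blast
    next
      case True
      have uminus_zero: "- 0\<^sub>m 1 k = (0\<^sub>m 1 k :: real mat)" for k by (intro eq_matI) auto
      have "(- x * v) $$ (0, 0) = 1" using True x(1) v(1) by simp
      moreover have "- x \<noteq> 0\<^sub>m 1 N"
      proof
        assume "- x = 0\<^sub>m 1 N"
        then have "x = - 0\<^sub>m 1 N" by (metis uminus_uminus_mat)
        then show False using x(2) uminus_zero by simp
      qed
      moreover have "- x * R = 0\<^sub>m 1 m" using x R uminus_zero[of m] by simp
      ultimately show thesis using that[of "- x"] x(1) by simp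
    qed
  qed
  let ?E = "v * w"
  have E: "?E \<in> carrier_mat N N" using v w by simp
  show thesis
  proof (cases "?E * Q = Q * ?E")
    case True
    obtain l where "w * Q = l \<cdot>\<^sub>m w"
      using left_eigenvector_if_commute[OF v w(1) Q True] .
    then have "indistinguishable A B C R S Q (Q + ?E)"
      by (rule indistinguishable_if_left_eigenvector[OF v(1) w(1) _ wR])
    moreover have "Q + ?E \<noteq> Q"
    proof
      assume eq: "Q + ?E = Q"
      obtain i where i: "i < N" "v $$ (i, 0) \<noteq> 0"
        using v by (metis One_nat_def carrier_matD eq_matI index_zero_mat less_one)
      obtain j where j: "j < N" "w $$ (0, j) \<noteq> 0"
        using w by (metis One_nat_def carrier_matD eq_matI index_zero_mat less_one)
      have "(Q + ?E) $$ (i, j) = Q $$ (i, j) + v $$ (i, 0) * w $$ (0, j)"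
        using i(1) j(1) v(1) w(1) Q by (auto simp: scalar_prod_def)
      then show False using eq i(2) j(2) by simp
    qed
    ultimately show thesis using that[of "Q + ?E"] add_carrier_mat[OF E] by blast
  next
    case False
    let ?P = "1\<^sub>m N + ?E"
    obtain P' where P': "P' \<in> carrier_mat N N" "P' * ?P = 1\<^sub>m N"
      using rank_one_update_left_inverse[OF v(1) w(1) refl s] E by (metis minus_carrier_mat smult_carrier_mat)
    have P: "?P \<in> carrier_mat N N" using E by simp
    let ?Q' = "?P * Q * P'"
    have PQ: "?P * Q \<in> carrier_mat N N" by (rule mult_carrier_mat[OF P Q])
    have Q': "?Q' \<in> carrier_mat N N" by (rule mult_carrier_mat[OF PQ P'(1)])
    have sim: "?P * Q = ?Q' * ?P"
      unfolding assoc_mult_mat[OF PQ P'(1) P] P'(2) right_mult_one_mat[OF PQ] ..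
    have "?E * R = 0\<^sub>m N m" unfolding assoc_mult_mat[OF v(1) w(1) R] wR using v by simp
    then have PR: "?P * R = R"
      unfolding add_mult_distrib_mat[OF one_carrier_mat E R] using R by simp
    have "S * ?E = 0\<^sub>m p N" using assoc_mult_mat[OF S v(1) w(1)] Sv w by simp
    then have SP: "S * ?P = S"
      unfolding mult_add_distrib_mat[OF S one_carrier_mat E] using S by simp
    have "?Q' \<noteq> Q"
    proof
      assume "?Q' = Q"
      then have "Q + ?E * Q = Q + Q * ?E"
        using sim add_mult_distrib_mat[OF one_carrier_mat E Q] mult_add_distrib_mat[OF Q one_carrier_mat E] Q
        by simp
      then have "Q + ?E * Q - Q = Q + Q * ?E - Q" by simp
      moreover have "Q + M - Q = M" if "M \<in> carrier_mat N N" for M :: "real mat"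
        using that Q by (intro eq_matI) auto
      ultimately show False using False mult_carrier_mat[OF E Q] mult_carrier_mat[OF Q E] by simp
    qed
    then show thesis
      using that Q' indistinguishable_if_similar[OF P Q' sim PR SP] by blast
  qed
qed

theorem theorem5:
  fixes N n\<^sub>0 m p :: nat
    and A B C :: "nat \<Rightarrow> real mat"
    and A\<^sub>0 B\<^sub>0 C\<^sub>0 Q R S :: "real mat"
  assumes "N \<ge> 1"
    and "A\<^sub>0 \<in> carrier_mat n\<^sub>0 n\<^sub>0" and "B\<^sub>0 \<in> carrier_mat n\<^sub>0 1" and "C\<^sub>0 \<in> carrier_mat 1 n\<^sub>0"
    and "\<And>i. i < N \<Longrightarrow> A i = A\<^sub>0" and "\<And>i. i < N \<Longrightarrow> B i = B\<^sub>0" and "\<And>i. i < N \<Longrightarrow> C i = C\<^sub>0"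
    and "Q \<in> carrier_mat N N" and "R \<in> carrier_mat N m" and "S \<in> carrier_mat p N"
    and "topology_identifiable (block_diag N A) (block_diag N B) (block_diag N C) R S Q"
  shows "vec_space.rank p S = N \<or> vec_space.rank N R = N"
proof (rule ccontr)
  assume neg: "\<not> ?thesis"
  interpret homogeneous_network N n\<^sub>0 m p A\<^sub>0 B\<^sub>0 C\<^sub>0 Q R S
    by unfold_locales (fact assms)+
  have blocks: "block_diag N A = kron (1\<^sub>m N) A\<^sub>0" "block_diag N B = kron (1\<^sub>m N) B\<^sub>0"
    "block_diag N C = kron (1\<^sub>m N) C\<^sub>0"
    using block_diag_const[OF assms(2)] block_diag_const[OF assms(3)] block_diag_const[OF assms(4)]
      assms(5-7) by blast+
  from neg have "vec_space.rank p S \<noteq> N" "vec_space.rank N R \<noteq> N" by simp_all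
  then obtain Q' where "Q' \<in> carrier_mat N N" "Q' \<noteq> Q"
    and "indistinguishable (block_diag N A) (block_diag N B) (block_diag N C) R S Q Q'"
    by (rule exists_indistinguishable[folded blocks])
  moreover have "dim_col (block_diag N B) = N" "dim_row (block_diag N C) = N"
    unfolding blocks using assms(3,4) by simp_all
  ultimately show False
    using assms(11) unfolding topology_identifiable_def by metis
qed

end
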